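(* Let $f$ be an epimorphism between the continuous groupoid actions $(\Xi,\rho,\theta,\Sigma)$ and $(\Xi,\rho',\theta',\Sigma')$. For every index $\alpha\in\{{\rm fix},{\rm per},{\rm wper},{\rm alper},{\rm rec},{\rm nw}\}$ one has $f(\Sigma_\alpha)\subset\Sigma'_\alpha$. In particular, $\rho(\Sigma_\alpha)\subset X_\alpha$, where $X_\alpha$ indicates the set of units of $X$ having the property $\alpha$ with respect to the canonical action of $\Xi$ on its unit space $X$.
   Context: All topological spaces are Hausdorff. A groupoid $\Xi$ is a small category in which all arrows are invertible; $X=\Xi^{(0)}$ is its unit space, $d,r:\Xi\to X$ are the source and range maps, and $\xi\eta$ is defined iff $d(\xi)=r(\eta)$. A topological groupoid is a groupoid with a (Hausdorff) topology making inversion and multiplication continuous (composable pairs carry the topology induced from $\Xi\times\Xi$); $X$ has the subspace topology. For $x\in X$, $\Xi_x=d^{-1}(\{x\})$. For $\mathsf A,\mathsf B\subset\Xi$, $\mathsf A\mathsf B=\{\xi\eta:\xi\in\mathsf A,\ \eta\in\mathsf B,\ d(\xi)=r(\eta)\}$. A continuous groupoid action $(\Xi,\rho,\theta,\Sigma)$ consists of a topological groupoid $\Xi$, a Hausdorff space $\Sigma$, a continuous surjection $\rho:\Sigma\to X$ (the anchor) and a continuous map $\theta:\{(\xi,\sigma)\in\Xi\times\Sigma: d(\xi)=\rho(\sigma)\}\to\Sigma$, $\theta_\xi(\sigma)=\xi\bullet\sigma$, with $\rho(\sigma)\bullet\sigma=\sigma$ and: if $d(\xi)=r(\eta)$ and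 $d(\eta)=\rho(\sigma)$ then $d(\xi)=\rho(\eta\bullet\sigma)$ and $(\xi\eta)\bullet\sigma=\xi\bullet(\eta\bullet\sigma)$. The canonical action of $\Xi$ on $X$ has anchor ${\rm id}_X$ and $\xi\circ d(\xi)=r(\xi)$. An epimorphism from $(\Xi,\rho,\theta,\Sigma)$ to $(\Xi,\rho',\theta',\Sigma')$ is a continuous surjection $f:\Sigma\to\Sigma'$ with $\rho'(f(\sigma))=\rho(\sigma)$ and $f(\theta_\xi(\sigma))=\theta'_\xi(f(\sigma))$ for all $\sigma\in\Sigma$, $\xi\in\Xi_{\rho(\sigma)}$. For $M,N\subset\Sigma$, $\xi\bullet M=\{\xi\bullet\sigma:\sigma\in M,\ \rho(\sigma)=d(\xi)\}$ and $\widetilde\Xi_M^N=\{\xi\in\Xi:(\xi\bullet M)\cap N\neq\emptyset\}$; singletons are written as points. For $\mathsf A\subset\Xi$, $\mathsf A\bullet\sigma=\{\xi\bullet\sigma:\xi\in\mathsf A,\ d(\xi)=\rho(\sigma)\}$. The limit set is $\mathfrak L_\sigma=\bigcap_{\mathsf K}\overline{(\Xi\setminus\mathsf K)\bullet\sigma}$, over all compact $\mathsf K\subset\Xi$. A subset $\mathsf A\subset\Xi_x$ is syndetic if $\mathsf K\mathsf A=\Xi_x$ for some compact $\mathsf K\subset\Xi$. The sets $\Sigma_\alpha$ (and similarly $\Sigma'_\alpha$, $X_\alpha$ for the other actions) are: $\Sigma_{\rm fix}$, points with $\xi\bullet\sigma=\sigma$ for all $\xi\in\Xi_{\rho(\sigma)}$;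 $\Sigma_{\rm per}$ (periodic), points with $\widetilde\Xi_\sigma^\sigma$ syndetic in $\Xi_{\rho(\sigma)}$; $\Sigma_{\rm wper}$ (weakly periodic), points with $\widetilde\Xi_\sigma^\sigma$ not compact; $\Sigma_{\rm alper}$ (almost periodic), points with $\widetilde\Xi_\sigma^U$ syndetic in $\Xi_{\rho(\sigma)}$ for every neighborhood $U$ of $\sigma$; $\Sigma_{\rm rec}$ (recurrent), points with $\sigma\in\mathfrak L_\sigma$; $\Sigma_{\rm nw}$ (non-wandering), points $\sigma$ such that for no neighborhood $W$ of $\sigma$ is $\widetilde\Xi_W^W$ relatively compact. For $\alpha\in\{{\rm rec},{\rm nw}\}$, the groupoid $\Xi$ is assumed strongly non-compact (i.e. $\Xi_x$ is non-compact for every $x\in X$), since these notions are introduced for such groupoids. *)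

theory Defs
  imports "HOL-Analysis.Analysis"
begin

text \<open>
  Spaces are abstract topologies, so that the unit space and the spaces acted upon may be
  arbitrary (possibly empty) Hausdorff spaces. Objects are identified with unit arrows. The
  operations are total functions; their values outside the carriers (for \<open>mult\<close> and \<open>act\<close>,
  on non-composable pairs) are irrelevant.
\<close>

record 'g groupoid_data =
  arr_top :: "'g topology"
  src :: "'g \<Rightarrow> 'g"
  rng :: "'g \<Rightarrow> 'g"
  mult :: "'g \<Rightarrow> 'g \<Rightarrow> 'g"
  ginv :: "'g \<Rightarrow> 'g"

definition arrows :: "'g groupoid_data \<Rightarrow> 'g set" where
  "arrows \<Xi> = topspace (arr_top \<Xi>)"

definition units :: "'g groupoid_data \<Rightarrow> 'g set" where
  "units \<Xi> = src \<Xi> ` arrows \<Xi>"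

definition unit_top :: "'g groupoid_data \<Rightarrow> 'g topology" where
  "unit_top \<Xi> = subtopology (arr_top \<Xi>) (units \<Xi>)"

locale topological_groupoid =
  fixes \<Xi> :: "'g groupoid_data"
  assumes Hausdorff_arr: "Hausdorff_space (arr_top \<Xi>)"
    and units_subset: "units \<Xi> \<subseteq> arrows \<Xi>"
    and rng_in_units: "\<xi> \<in> arrows \<Xi> \<Longrightarrow> rng \<Xi> \<xi> \<in> units \<Xi>"
    and src_unit: "x \<in> units \<Xi> \<Longrightarrow> src \<Xi> x = x"
    and rng_unit: "x \<in> units \<Xi> \<Longrightarrow> rng \<Xi> x = x"
    and mult_in_arrows:
      "\<lbrakk>\<xi> \<in> arrows \<Xi>; \<eta> \<in> arrows \<Xi>; src \<Xi> \<xi> = rng \<Xi> \<eta>\<rbrakk> \<Longrightarrow> mult \<Xi> \<xi> \<eta> \<in> arrows \<Xi>"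
    and src_mult:
      "\<lbrakk>\<xi> \<in> arrows \<Xi>; \<eta> \<in> arrows \<Xi>; src \<Xi> \<xi> = rng \<Xi> \<eta>\<rbrakk> \<Longrightarrow> src \<Xi> (mult \<Xi> \<xi> \<eta>) = src \<Xi> \<eta>"
    and rng_mult:
      "\<lbrakk>\<xi> \<in> arrows \<Xi>; \<eta> \<in> arrows \<Xi>; src \<Xi> \<xi> = rng \<Xi> \<eta>\<rbrakk> \<Longrightarrow> rng \<Xi> (mult \<Xi> \<xi> \<eta>) = rng \<Xi> \<xi>"
    and mult_assoc:
      "\<lbrakk>\<xi> \<in> arrows \<Xi>; \<eta> \<in> arrows \<Xi>; \<zeta> \<in> arrows \<Xi>; src \<Xi> \<xi> = rng \<Xi> \<eta>; src \<Xi> \<eta> = rng \<Xi> \<zeta>\<rbrakk>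
        \<Longrightarrow> mult \<Xi> (mult \<Xi> \<xi> \<eta>) \<zeta> = mult \<Xi> \<xi> (mult \<Xi> \<eta> \<zeta>)"
    and mult_src: "\<xi> \<in> arrows \<Xi> \<Longrightarrow> mult \<Xi> \<xi> (src \<Xi> \<xi>) = \<xi>"
    and mult_rng: "\<xi> \<in> arrows \<Xi> \<Longrightarrow> mult \<Xi> (rng \<Xi> \<xi>) \<xi> = \<xi>"
    and ginv_in_arrows: "\<xi> \<in> arrows \<Xi> \<Longrightarrow> ginv \<Xi> \<xi> \<in> arrows \<Xi>"
    and src_ginv: "\<xi> \<in> arrows \<Xi> \<Longrightarrow> src \<Xi> (ginv \<Xi> \<xi>) = rng \<Xi> \<xi>"
    and rng_ginv: "\<xi> \<in> arrows \<Xi> \<Longrightarrow> rng \<Xi> (ginv \<Xi> \<xi>) = src \<Xi> \<xi>"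
    and ginv_mult: "\<xi> \<in> arrows \<Xi> \<Longrightarrow> mult \<Xi> (ginv \<Xi> \<xi>) \<xi> = src \<Xi> \<xi>"
    and mult_ginv: "\<xi> \<in> arrows \<Xi> \<Longrightarrow> mult \<Xi> \<xi> (ginv \<Xi> \<xi>) = rng \<Xi> \<xi>"
    and continuous_ginv: "continuous_map (arr_top \<Xi>) (arr_top \<Xi>) (ginv \<Xi>)"
    and continuous_mult:
      "continuous_map
        (subtopology (prod_topology (arr_top \<Xi>) (arr_top \<Xi>)) {(\<xi>, \<eta>). src \<Xi> \<xi> = rng \<Xi> \<eta>})
        (arr_top \<Xi>) (\<lambda>(\<xi>, \<eta>). mult \<Xi> \<xi> \<eta>)"

definition src_fiber :: "'g groupoid_data \<Rightarrow> 'g \<Rightarrow> 'g set" where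
  "src_fiber \<Xi> x = {\<xi> \<in> arrows \<Xi>. src \<Xi> \<xi> = x}"

definition set_mult :: "'g groupoid_data \<Rightarrow> 'g set \<Rightarrow> 'g set \<Rightarrow> 'g set" where
  "set_mult \<Xi> A B = {mult \<Xi> \<xi> \<eta> | \<xi> \<eta>. \<xi> \<in> A \<and> \<eta> \<in> B \<and> src \<Xi> \<xi> = rng \<Xi> \<eta>}"

definition strongly_noncompact :: "'g groupoid_data \<Rightarrow> bool" where
  "strongly_noncompact \<Xi> \<longleftrightarrow> (\<forall>x\<in>units \<Xi>. \<not> compactin (arr_top \<Xi>) (src_fiber \<Xi> x))"

definition syndetic :: "'g groupoid_data \<Rightarrow> 'g \<Rightarrow> 'g set \<Rightarrow> bool" where
  "syndetic \<Xi> x A \<longleftrightarrow> A \<subseteq> src_fiber \<Xi> x \<and>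
     (\<exists>K. compactin (arr_top \<Xi>) K \<and> set_mult \<Xi> K A = src_fiber \<Xi> x)"

record ('g, 's) action_data =
  pt_top :: "'s topology"
  anchor :: "'s \<Rightarrow> 'g"
  act :: "'g \<Rightarrow> 's \<Rightarrow> 's"

definition points :: "('g, 's) action_data \<Rightarrow> 's set" where
  "points S = topspace (pt_top S)"

locale groupoid_action = topological_groupoid \<Xi>
  for \<Xi> :: "'g groupoid_data" +
  fixes S :: "('g, 's) action_data"
  assumes Hausdorff_pt: "Hausdorff_space (pt_top S)"
    and continuous_anchor: "continuous_map (pt_top S) (unit_top \<Xi>) (anchor S)"
    and anchor_surj: "anchor S ` points S = units \<Xi>"
    and continuous_act:
      "continuous_map
        (subtopology (prod_topology (arr_top \<Xi>) (pt_top S)) {(\<xi>, \<sigma>). src \<Xi> \<xi> = anchor S \<sigma>})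
        (pt_top S) (\<lambda>(\<xi>, \<sigma>). act S \<xi> \<sigma>)"
    and act_unit: "\<sigma> \<in> points S \<Longrightarrow> act S (anchor S \<sigma>) \<sigma> = \<sigma>"
    and anchor_act:
      "\<lbrakk>\<xi> \<in> arrows \<Xi>; \<eta> \<in> arrows \<Xi>; \<sigma> \<in> points S; src \<Xi> \<xi> = rng \<Xi> \<eta>; src \<Xi> \<eta> = anchor S \<sigma>\<rbrakk>
        \<Longrightarrow> src \<Xi> \<xi> = anchor S (act S \<eta> \<sigma>)"
    and act_mult:
      "\<lbrakk>\<xi> \<in> arrows \<Xi>; \<eta> \<in> arrows \<Xi>; \<sigma> \<in> points S; src \<Xi> \<xi> = rng \<Xi> \<eta>; src \<Xi> \<eta> = anchor S \<sigma>\<rbrakk>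
        \<Longrightarrow> act S (mult \<Xi> \<xi> \<eta>) \<sigma> = act S \<xi> (act S \<eta> \<sigma>)"

definition canonical_action :: "'g groupoid_data \<Rightarrow> ('g, 'g) action_data" where
  "canonical_action \<Xi> = \<lparr>pt_top = unit_top \<Xi>, anchor = (\<lambda>x. x), act = (\<lambda>\<xi> x. rng \<Xi> \<xi>)\<rparr>"

definition epimorphism ::
  "'g groupoid_data \<Rightarrow> ('g, 's) action_data \<Rightarrow> ('g, 't) action_data \<Rightarrow> ('s \<Rightarrow> 't) \<Rightarrow> bool" where
  "epimorphism \<Xi> S S' f \<longleftrightarrow>
     continuous_map (pt_top S) (pt_top S') f \<and>
     f ` points S = points S' \<and>
     (\<forall>\<sigma>\<in>points S. anchor S' (f \<sigma>) = anchor S \<sigma>) \<and>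
     (\<forall>\<sigma>\<in>points S. \<forall>\<xi>\<in>src_fiber \<Xi> (anchor S \<sigma>). f (act S \<xi> \<sigma>) = act S' \<xi> (f \<sigma>))"

definition translate :: "'g groupoid_data \<Rightarrow> ('g, 's) action_data \<Rightarrow> 'g \<Rightarrow> 's set \<Rightarrow> 's set" where
  "translate \<Xi> S \<xi> M = {act S \<xi> \<sigma> | \<sigma>. \<sigma> \<in> M \<and> anchor S \<sigma> = src \<Xi> \<xi>}"

definition return_set ::
  "'g groupoid_data \<Rightarrow> ('g, 's) action_data \<Rightarrow> 's set \<Rightarrow> 's set \<Rightarrow> 'g set" where
  "return_set \<Xi> S M N = {\<xi> \<in> arrows \<Xi>. translate \<Xi> S \<xi> M \<inter> N \<noteq> {}}"

definition partial_orbit ::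
  "'g groupoid_data \<Rightarrow> ('g, 's) action_data \<Rightarrow> 'g set \<Rightarrow> 's \<Rightarrow> 's set" where
  "partial_orbit \<Xi> S A \<sigma> = {act S \<xi> \<sigma> | \<xi>. \<xi> \<in> A \<and> src \<Xi> \<xi> = anchor S \<sigma>}"

definition limit_set :: "'g groupoid_data \<Rightarrow> ('g, 's) action_data \<Rightarrow> 's \<Rightarrow> 's set" where
  "limit_set \<Xi> S \<sigma> =
     (\<Inter>K\<in>{K. compactin (arr_top \<Xi>) K}. pt_top S closure_of partial_orbit \<Xi> S (arrows \<Xi> - K) \<sigma>)"

definition nbhd_in :: "'a topology \<Rightarrow> 'a \<Rightarrow> 'a set \<Rightarrow> bool" where
  "nbhd_in T x U \<longleftrightarrow> U \<subseteq> topspace T \<and> (\<exists>V. openin T V \<and> x \<in> V \<and> V \<subseteq> U)"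

definition relatively_compactin :: "'a topology \<Rightarrow> 'a set \<Rightarrow> bool" where
  "relatively_compactin T A \<longleftrightarrow> A \<subseteq> topspace T \<and> compactin T (T closure_of A)"

datatype dyn_type = Fix | Per | WPer | AlPer | Rec | NW

primrec has_type ::
  "'g groupoid_data \<Rightarrow> ('g, 's) action_data \<Rightarrow> dyn_type \<Rightarrow> 's \<Rightarrow> bool" where
  "has_type \<Xi> S Fix \<sigma> \<longleftrightarrow> (\<forall>\<xi>\<in>src_fiber \<Xi> (anchor S \<sigma>). act S \<xi> \<sigma> = \<sigma>)"
| "has_type \<Xi> S Per \<sigma> \<longleftrightarrow> syndetic \<Xi> (anchor S \<sigma>) (return_set \<Xi> S {\<sigma>} {\<sigma>})"
| "has_type \<Xi> S WPer \<sigma> \<longleftrightarrow> \<not> compactin (arr_top \<Xi>) (return_set \<Xi> S {\<sigma>} {\<sigma>})"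
| "has_type \<Xi> S AlPer \<sigma> \<longleftrightarrow>
     (\<forall>U. nbhd_in (pt_top S) \<sigma> U \<longrightarrow> syndetic \<Xi> (anchor S \<sigma>) (return_set \<Xi> S {\<sigma>} U))"
| "has_type \<Xi> S Rec \<sigma> \<longleftrightarrow> \<sigma> \<in> limit_set \<Xi> S \<sigma>"
| "has_type \<Xi> S NW \<sigma> \<longleftrightarrow>
     \<not> (\<exists>W. nbhd_in (pt_top S) \<sigma> W \<and> relatively_compactin (arr_top \<Xi>) (return_set \<Xi> S W W))"

definition type_points ::
  "'g groupoid_data \<Rightarrow> ('g, 's) action_data \<Rightarrow> dyn_type \<Rightarrow> 's set" where
  "type_points \<Xi> S \<alpha> = {\<sigma> \<in> points S. has_type \<Xi> S \<alpha> \<sigma>}"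

end

theory Submission
  imports Defs
begin

text \<open>
  For four of the six properties everything rests on one inclusion: an equivariant map can only
  enlarge the sets of arrows that carry one region to another. If \<open>\<xi>\<close> moves some point of \<open>M\<close>
  into \<open>N\<close>, then it moves the image of that point into every set containing \<open>f ` N\<close>
  (\<open>return_set_mono\<close>). Periodic, weakly periodic, almost periodic and non-wandering points are
  those for which certain return sets are large, and each notion of largeness passes to bigger
  sets: being syndetic in a fiber does by \<open>syndetic_mono\<close>, failing to be relatively compact always
  does, and failing to be compact does for the return sets of points to themselves because these
  are closed (\<open>closedin_stabilizer\<close>), hence compact whenever they lie in a compact set. Continuity
  of \<open>f\<close> lets neighbourhoods be pulled back.

  The other two properties concern orbits directly. A fixed point maps to a fixed point by
  equivariance. For recurrent points, \<open>f\<close> maps the part of an orbit outside a compact set of arrows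
  to the corresponding part of the image orbit, and being continuous it maps closures into
  closures (\<open>limit_set_image\<close>).

  The statement about the anchor is the same statement for another epimorphism: the unit space is
  itself a groupoid action, and the anchor of any action is an epimorphism onto it
  (\<open>groupoid_action_canonical\<close>, \<open>epimorphism_anchor\<close>).
\<close>

section \<open>The source and range maps\<close>

context topological_groupoid
begin

text \<open>
  The axioms impose continuity on inversion and multiplication only; the source map inherits it
  from the formula \<open>d(\<xi>) = \<xi>\<^sup>-\<^sup>1 \<xi>\<close>, and the range map is the source map after inversion.
\<close>

lemma continuous_src: "continuous_map (arr_top \<Xi>) (arr_top \<Xi>) (src \<Xi>)"
proof -
  have "continuous_map (arr_top \<Xi>)
      (subtopology (prod_topology (arr_top \<Xi>) (arr_top \<Xi>)) {(\<xi>, \<eta>). src \<Xi> \<xi> = rng \<Xi> \<eta>})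
      (\<lambda>\<xi>. (ginv \<Xi> \<xi>, \<xi>))"
    using continuous_ginv src_ginv
    by (auto simp: continuous_map_in_subtopology continuous_map_pairedI arrows_def)
  from continuous_map_compose[OF this continuous_mult]
  show ?thesis
    by (rule continuous_map_eq) (simp add: ginv_mult arrows_def)
qed

lemma continuous_rng: "continuous_map (arr_top \<Xi>) (unit_top \<Xi>) (rng \<Xi>)"
proof -
  have "continuous_map (arr_top \<Xi>) (arr_top \<Xi>) (rng \<Xi>)"
    using continuous_map_compose[OF continuous_ginv continuous_src]
    by (rule continuous_map_eq) (simp add: src_ginv arrows_def)
  then show ?thesis
    using rng_in_units by (auto simp: unit_top_def continuous_map_in_subtopology arrows_def)
qed

lemma topspace_unit_top: "topspace (unit_top \<Xi>) = units \<Xi>"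
  using units_subset by (auto simp: unit_top_def arrows_def)

lemma closedin_src_fiber:
  assumes "x \<in> units \<Xi>"
  shows "closedin (arr_top \<Xi>) (src_fiber \<Xi> x)"
proof -
  have "closedin (arr_top \<Xi>) {x}"
    using assms units_subset Hausdorff_arr
    by (auto simp: arrows_def intro: closedin_Hausdorff_singleton)
  from closedin_continuous_map_preimage[OF continuous_src this]
  show ?thesis
    by (simp add: src_fiber_def arrows_def)
qed

text \<open>
  The compact set that works for \<open>A\<close> works for \<open>B\<close>: the product cannot leave the fiber, because
  multiplying on the left does not change the source.
\<close>

lemma syndetic_mono:
  assumes "syndetic \<Xi> x A" "A \<subseteq> B" "B \<subseteq> src_fiber \<Xi> x"
  shows "syndetic \<Xi> x B"
proof -
  obtain K where K: "compactin (arr_top \<Xi>) K" "set_mult \<Xi> K A = src_fiber \<Xi> x"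
    using assms(1) by (auto simp: syndetic_def)
  have "K \<subseteq> arrows \<Xi>"
    using K(1) by (simp add: compactin_subset_topspace arrows_def)
  then have "set_mult \<Xi> K B \<subseteq> src_fiber \<Xi> x"
    using assms(3) by (auto simp: set_mult_def src_fiber_def subset_iff mult_in_arrows src_mult)
  moreover have "set_mult \<Xi> K A \<subseteq> set_mult \<Xi> K B"
    using assms(2) by (auto simp: set_mult_def)
  ultimately have "set_mult \<Xi> K B = src_fiber \<Xi> x"
    using K(2) by blast
  then show ?thesis
    using K(1) assms(3) by (auto simp: syndetic_def)
qed

end

section \<open>Actions and their return sets\<close>

lemma return_set_point:
  "return_set \<Xi> S {\<sigma>} N = {\<xi> \<in> src_fiber \<Xi> (anchor S \<sigma>). act S \<xi> \<sigma> \<in> N}"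
  by (auto simp: return_set_def translate_def src_fiber_def)

context groupoid_action
begin

lemma anchor_in_units: "\<sigma> \<in> points S \<Longrightarrow> anchor S \<sigma> \<in> units \<Xi>"
  using anchor_surj by blast

lemma act_in_points:
  assumes "\<sigma> \<in> points S" "\<xi> \<in> src_fiber \<Xi> (anchor S \<sigma>)"
  shows "act S \<xi> \<sigma> \<in> points S"
  using continuous_map_image_subset_topspace[OF continuous_act] assms
  by (force simp: image_subset_iff points_def src_fiber_def arrows_def)

text \<open>
  The axioms mention the anchor of \<open>\<xi> \<bullet> \<sigma>\<close> only when a further arrow can be applied to this point;
  the inverse of \<open>\<xi>\<close> is such an arrow.
\<close>

lemma anchor_act_eq_rng:
  assumes "\<sigma> \<in> points S" "\<xi> \<in> src_fiber \<Xi> (anchor S \<sigma>)"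
  shows "anchor S (act S \<xi> \<sigma>) = rng \<Xi> \<xi>"
  using anchor_act[of "ginv \<Xi> \<xi>" \<xi> \<sigma>] assms
  by (simp add: src_fiber_def ginv_in_arrows src_ginv)

lemma continuous_orbit_map:
  assumes "\<sigma> \<in> points S"
  shows "continuous_map (subtopology (arr_top \<Xi>) (src_fiber \<Xi> (anchor S \<sigma>))) (pt_top S)
    (\<lambda>\<xi>. act S \<xi> \<sigma>)"
proof -
  let ?F = "subtopology (arr_top \<Xi>) (src_fiber \<Xi> (anchor S \<sigma>))"
  have "continuous_map ?F
      (subtopology (prod_topology (arr_top \<Xi>) (pt_top S)) {(\<xi>, \<sigma>). src \<Xi> \<xi> = anchor S \<sigma>})
      (\<lambda>\<xi>. (\<xi>, \<sigma>))"
    using assms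
    by (auto simp: continuous_map_in_subtopology continuous_map_pairedI points_def src_fiber_def)
  from continuous_map_compose[OF this continuous_act]
  show ?thesis
    by (simp add: o_def)
qed

text \<open>
  The stabilizer is the preimage of a closed point under the orbit map, which is defined on a fiber
  of the source map, itself closed.
\<close>

lemma closedin_stabilizer:
  assumes "\<sigma> \<in> points S"
  shows "closedin (arr_top \<Xi>) (return_set \<Xi> S {\<sigma>} {\<sigma>})"
proof -
  let ?F = "src_fiber \<Xi> (anchor S \<sigma>)"
  have "closedin (pt_top S) {\<sigma>}"
    using assms Hausdorff_pt by (auto simp: points_def intro: closedin_Hausdorff_singleton)
  from closedin_continuous_map_preimage[OF continuous_orbit_map[OF assms] this]
  have "closedin (subtopology (arr_top \<Xi>) ?F)
      {\<xi> \<in> topspace (subtopology (arr_top \<Xi>) ?F). act S \<xi> \<sigma> \<in> {\<sigma>}}" .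
  moreover have "{\<xi> \<in> topspace (subtopology (arr_top \<Xi>) ?F). act S \<xi> \<sigma> \<in> {\<sigma>}}
      = return_set \<Xi> S {\<sigma>} {\<sigma>}"
    by (auto simp: return_set_point src_fiber_def arrows_def)
  ultimately show ?thesis
    using closedin_trans_full closedin_src_fiber anchor_in_units[OF assms] by metis
qed

end

section \<open>The canonical action and the anchor\<close>

lemma points_canonical_action:
  assumes "topological_groupoid \<Xi>"
  shows "points (canonical_action \<Xi>) = units \<Xi>"
  using topological_groupoid.topspace_unit_top[OF assms]
  by (simp add: points_def canonical_action_def)

lemma groupoid_action_canonical:
  assumes "topological_groupoid \<Xi>"
  shows "groupoid_action \<Xi> (canonical_action \<Xi>)"
proof -
  interpret topological_groupoid \<Xi> by fact
  have "continuous_map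
      (subtopology (prod_topology (arr_top \<Xi>) (unit_top \<Xi>)) {(\<xi>, x). src \<Xi> \<xi> = x})
      (unit_top \<Xi>) (rng \<Xi> \<circ> fst)"
    by (intro continuous_map_compose[OF _ continuous_rng] continuous_map_from_subtopology
        continuous_map_fst)
  then have act: "continuous_map
      (subtopology (prod_topology (arr_top \<Xi>) (unit_top \<Xi>)) {(\<xi>, x). src \<Xi> \<xi> = x})
      (unit_top \<Xi>) (\<lambda>(\<xi>, x). rng \<Xi> \<xi>)"
    by (simp add: o_def case_prod_unfold)
  have "Hausdorff_space (unit_top \<Xi>)"
    by (simp add: unit_top_def Hausdorff_arr Hausdorff_space_subtopology)
  with act show ?thesis
    by unfold_locales
      (auto simp: canonical_action_def points_def topspace_unit_top rng_mult rng_unit)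
qed

lemma epimorphism_anchor:
  assumes "groupoid_action \<Xi> S"
  shows "epimorphism \<Xi> S (canonical_action \<Xi>) (anchor S)"
proof -
  interpret groupoid_action \<Xi> S by fact
  show ?thesis
    unfolding epimorphism_def points_canonical_action[OF topological_groupoid_axioms]
    using continuous_anchor anchor_surj anchor_act_eq_rng
    by (simp add: canonical_action_def)
qed

section \<open>Epimorphisms preserve the dynamical types\<close>

locale action_epimorphism =
  A: groupoid_action \<Xi> S + B: groupoid_action \<Xi> S'
  for \<Xi> :: "'g groupoid_data" and S :: "('g, 's) action_data" and S' :: "('g, 't) action_data" +
  fixes f :: "'s \<Rightarrow> 't"
  assumes epi: "epimorphism \<Xi> S S' f"
begin

lemma continuous: "continuous_map (pt_top S) (pt_top S') f"
  using epi by (simp add: epimorphism_def)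

lemma map_in_points: "\<sigma> \<in> points S \<Longrightarrow> f \<sigma> \<in> points S'"
  using epi by (auto simp: epimorphism_def)

lemma anchor_map: "\<sigma> \<in> points S \<Longrightarrow> anchor S' (f \<sigma>) = anchor S \<sigma>"
  using epi by (simp add: epimorphism_def)

lemma map_act:
  "\<lbrakk>\<sigma> \<in> points S; \<xi> \<in> src_fiber \<Xi> (anchor S \<sigma>)\<rbrakk> \<Longrightarrow> f (act S \<xi> \<sigma>) = act S' \<xi> (f \<sigma>)"
  using epi by (simp add: epimorphism_def)

lemma return_set_mono:
  assumes "M \<subseteq> points S" "f ` M \<subseteq> M'" "f ` (N \<inter> points S) \<subseteq> N'"
  shows "return_set \<Xi> S M N \<subseteq> return_set \<Xi> S' M' N'"
proof
  fix \<xi> assume "\<xi> \<in> return_set \<Xi> S M N"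
  then obtain \<sigma> where \<xi>: "\<xi> \<in> arrows \<Xi>" and \<sigma>: "\<sigma> \<in> M" "anchor S \<sigma> = src \<Xi> \<xi>" "act S \<xi> \<sigma> \<in> N"
    by (auto simp: return_set_def translate_def)
  have fib: "\<sigma> \<in> points S" "\<xi> \<in> src_fiber \<Xi> (anchor S \<sigma>)"
    using \<xi> \<sigma> assms(1) by (auto simp: src_fiber_def)
  have "act S' \<xi> (f \<sigma>) \<in> N'"
    using A.act_in_points[OF fib] map_act[OF fib] \<sigma>(3) assms(3) by force
  moreover have "f \<sigma> \<in> M'" "anchor S' (f \<sigma>) = src \<Xi> \<xi>"
    using \<sigma> fib assms(2) anchor_map by auto
  ultimately show "\<xi> \<in> return_set \<Xi> S' M' N'"
    using \<xi> by (auto simp: return_set_def translate_def)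
qed

lemma return_set_point_mono:
  assumes "\<sigma> \<in> points S" "f ` (N \<inter> points S) \<subseteq> N'"
  shows "return_set \<Xi> S {\<sigma>} N \<subseteq> return_set \<Xi> S' {f \<sigma>} N'"
  using assms by (intro return_set_mono) auto

lemma syndetic_return_set_mono:
  assumes "\<sigma> \<in> points S" "f ` (N \<inter> points S) \<subseteq> N'"
    and "syndetic \<Xi> (anchor S \<sigma>) (return_set \<Xi> S {\<sigma>} N)"
  shows "syndetic \<Xi> (anchor S' (f \<sigma>)) (return_set \<Xi> S' {f \<sigma>} N')"
  using A.syndetic_mono[OF assms(3) return_set_point_mono[OF assms(1,2)]] anchor_map[OF assms(1)]
  by (auto simp: return_set_point)

lemma nbhd_preimage:
  assumes "\<sigma> \<in> points S" "nbhd_in (pt_top S') (f \<sigma>) U"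
  shows "nbhd_in (pt_top S) \<sigma> {\<tau> \<in> points S. f \<tau> \<in> U}"
proof -
  obtain V where V: "openin (pt_top S') V" "f \<sigma> \<in> V" "V \<subseteq> U"
    using assms(2) by (auto simp: nbhd_in_def)
  have "openin (pt_top S) {\<tau> \<in> points S. f \<tau> \<in> V}"
    using openin_continuous_map_preimage[OF continuous V(1)] by (simp add: points_def)
  moreover have "\<sigma> \<in> {\<tau> \<in> points S. f \<tau> \<in> V}" "{\<tau> \<in> points S. f \<tau> \<in> V} \<subseteq> {\<tau> \<in> points S. f \<tau> \<in> U}"
    using assms(1) V by auto
  moreover have "{\<tau> \<in> points S. f \<tau> \<in> U} \<subseteq> topspace (pt_top S)"
    by (auto simp: points_def)
  ultimately show ?thesis
    unfolding nbhd_in_def by blast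
qed

lemma image_partial_orbit:
  assumes "\<sigma> \<in> points S" "A \<subseteq> arrows \<Xi>"
  shows "f ` partial_orbit \<Xi> S A \<sigma> \<subseteq> partial_orbit \<Xi> S' A (f \<sigma>)"
proof clarify
  fix \<tau> assume "\<tau> \<in> partial_orbit \<Xi> S A \<sigma>"
  then obtain \<xi> where "\<xi> \<in> A" "src \<Xi> \<xi> = anchor S \<sigma>" "\<tau> = act S \<xi> \<sigma>"
    by (auto simp: partial_orbit_def)
  moreover from this have "f \<tau> = act S' \<xi> (f \<sigma>)"
    using assms map_act by (auto simp: src_fiber_def)
  ultimately show "f \<tau> \<in> partial_orbit \<Xi> S' A (f \<sigma>)"
    using assms(1) anchor_map by (auto simp: partial_orbit_def)
qed

lemma limit_set_image:
  assumes "\<sigma> \<in> points S"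
  shows "f ` limit_set \<Xi> S \<sigma> \<subseteq> limit_set \<Xi> S' (f \<sigma>)"
proof -
  have "f ` (pt_top S closure_of partial_orbit \<Xi> S (arrows \<Xi> - K) \<sigma>)
      \<subseteq> pt_top S' closure_of partial_orbit \<Xi> S' (arrows \<Xi> - K) (f \<sigma>)" for K
    using continuous_map_image_closure_subset[OF continuous]
      closure_of_mono[OF image_partial_orbit[OF assms Diff_subset]]
    by (rule order_trans)
  then show ?thesis
    by (fastforce simp: limit_set_def)
qed

lemma has_type_image:
  assumes \<sigma>: "\<sigma> \<in> points S" and type: "has_type \<Xi> S \<alpha> \<sigma>"
  shows "has_type \<Xi> S' \<alpha> (f \<sigma>)"
proof (cases \<alpha>)
  case Fix
  then show ?thesis
    using type map_act[OF \<sigma>] anchor_map[OF \<sigma>] by force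
next
  case Per
  then show ?thesis
    using type syndetic_return_set_mono[OF \<sigma>, of "{\<sigma>}" "{f \<sigma>}"] by auto
next
  case WPer
  have "compactin (arr_top \<Xi>) (return_set \<Xi> S {\<sigma>} {\<sigma>})"
    if "compactin (arr_top \<Xi>) (return_set \<Xi> S' {f \<sigma>} {f \<sigma>})"
    using closed_compactin[OF that _ A.closedin_stabilizer[OF \<sigma>]]
      return_set_point_mono[OF \<sigma>, of "{\<sigma>}" "{f \<sigma>}"] by auto
  then show ?thesis
    using type WPer by auto
next
  case AlPer
  have "syndetic \<Xi> (anchor S' (f \<sigma>)) (return_set \<Xi> S' {f \<sigma>} U)"
    if "nbhd_in (pt_top S') (f \<sigma>) U" for U
    using type AlPer nbhd_preimage[OF \<sigma> that]
    by (intro syndetic_return_set_mono[OF \<sigma>, of "{\<tau> \<in> points S. f \<tau> \<in> U}"]) auto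
  then show ?thesis
    using AlPer by simp
next
  case Rec
  then show ?thesis
    using type limit_set_image[OF \<sigma>] by auto
next
  case NW
  have "\<exists>W. nbhd_in (pt_top S) \<sigma> W \<and> relatively_compactin (arr_top \<Xi>) (return_set \<Xi> S W W)"
    if W: "nbhd_in (pt_top S') (f \<sigma>) W"
      and rc: "relatively_compactin (arr_top \<Xi>) (return_set \<Xi> S' W W)" for W
  proof -
    let ?V = "{\<tau> \<in> points S. f \<tau> \<in> W}"
    have sub: "return_set \<Xi> S ?V ?V \<subseteq> return_set \<Xi> S' W W"
      by (rule return_set_mono) auto
    have "compactin (arr_top \<Xi>) (arr_top \<Xi> closure_of return_set \<Xi> S ?V ?V)"
      using closed_compactin[OF _ closure_of_mono[OF sub] closedin_closure_of] rc
      by (simp add: relatively_compactin_def)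
    then have "relatively_compactin (arr_top \<Xi>) (return_set \<Xi> S ?V ?V)"
      using rc sub by (auto simp: relatively_compactin_def)
    then show ?thesis
      using nbhd_preimage[OF \<sigma> W] by blast
  qed
  then show ?thesis
    using type NW by auto
qed

lemma image_type_points: "f ` type_points \<Xi> S \<alpha> \<subseteq> type_points \<Xi> S' \<alpha>"
  using has_type_image map_in_points by (auto simp: type_points_def)

end

theorem theorem7p6:
  fixes \<Xi> :: "'g groupoid_data"
    and S :: "('g, 's) action_data"
    and S' :: "('g, 't) action_data"
    and f :: "'s \<Rightarrow> 't"
    and \<alpha> :: dyn_type
  assumes "groupoid_action \<Xi> S"
    and "groupoid_action \<Xi> S'"
    and "epimorphism \<Xi> S S' f"
    and "\<alpha> \<in> {Rec, NW} \<Longrightarrow> strongly_noncompact \<Xi>"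
  shows "f ` type_points \<Xi> S \<alpha> \<subseteq> type_points \<Xi> S' \<alpha> \<and>
    anchor S ` type_points \<Xi> S \<alpha> \<subseteq> type_points \<Xi> (canonical_action \<Xi>) \<alpha>"
proof
  have "action_epimorphism \<Xi> S S' f"
    using assms(1-3) by (simp add: action_epimorphism_def action_epimorphism_axioms_def)
  then show "f ` type_points \<Xi> S \<alpha> \<subseteq> type_points \<Xi> S' \<alpha>"
    by (rule action_epimorphism.image_type_points)
next
  have "action_epimorphism \<Xi> S (canonical_action \<Xi>) (anchor S)"
    using assms(1) groupoid_action_canonical[of \<Xi>] epimorphism_anchor[OF assms(1)]
    by (simp add: action_epimorphism_def action_epimorphism_axioms_def groupoid_action_def)
  then show "anchor S ` type_points \<Xi> S \<alpha> \<subseteq> type_points \<Xi> (canonical_action \<Xi>) \<alpha>"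
    by (rule action_epimorphism.image_type_points)
qed

end
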